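(* For any fixed integer $r\geq 2$, $$m(n,r)= \Omega\left( \left(\frac{n}{\ln(n)}\right)^{\frac{r-1}{r}} r^n\right)\qquad\text{as } n\to\infty.$$ That is, for every integer $r\ge 2$ there exist a constant $C=C(r)>0$ and an integer $n_0=n_0(r)$ such that $m(n,r)\geq C\left(\frac{n}{\ln(n)}\right)^{\frac{r-1}{r}} r^n$ for all integers $n\ge n_0$.
   Context: A (finite) hypergraph is a pair $(V,E)$, where $V$ is a finite set of vertices and $E$ is a family (set) of subsets of $V$, called edges. It is $n$-uniform if all its edges have exactly $n$ elements. It is $r$-colorable if there exists a function $c:V\to\{1,\ldots,r\}$ such that no edge is monochromatic, i.e. the image under $c$ of every edge has at least two elements. For $n,r\in\mathbb{N}$, $m(n,r)$ denotes the smallest number of edges of an $n$-uniform hypergraph that is not $r$-colorable. The asymptotics are for fixed $r$ and $n$ tending to infinity. *)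

theory Defs
  imports Complex_Main
begin

definition hypergraph :: "'a set \<Rightarrow> 'a set set \<Rightarrow> bool" where
  "hypergraph V E \<longleftrightarrow> finite V \<and> E \<subseteq> Pow V"

definition uniform :: "nat \<Rightarrow> 'a set set \<Rightarrow> bool" where
  "uniform n E \<longleftrightarrow> (\<forall>e\<in>E. card e = n)"

definition colorable :: "nat \<Rightarrow> 'a set \<Rightarrow> 'a set set \<Rightarrow> bool" where
  "colorable r V E \<longleftrightarrow> (\<exists>c :: 'a \<Rightarrow> nat. c ` V \<subseteq> {1..r} \<and> (\<forall>e\<in>E. card (c ` e) \<ge> 2))"

text \<open>The number $m(n,r)$. The vertices are taken to be natural numbers, which loses no generality
  as every finite hypergraph is isomorphic to such a one; see \<open>min_edges_le\<close>. The minimum is attained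
  whenever $r$ is positive; see \<open>min_edges_attained\<close>.\<close>

definition min_edges :: "nat \<Rightarrow> nat \<Rightarrow> nat" where
  "min_edges n r = (LEAST k. \<exists>(V :: nat set) E.
     hypergraph V E \<and> uniform n E \<and> \<not> colorable r V E \<and> card E = k)"

lemma min_edges_le:
  fixes V :: "'a set"
  assumes "hypergraph V E" "uniform n E" "\<not> colorable r V E"
  shows "min_edges n r \<le> card E"
proof -
  have fV: "finite V" and EV: "E \<subseteq> Pow V"
    using assms(1) by (auto simp: hypergraph_def)
  obtain f :: "'a \<Rightarrow> nat" where f: "inj_on f V"
    using fV finite_imp_inj_to_nat_seg by blast
  have inj: "inj_on ((`) f) E"
    using inj_on_image_Pow[OF f] EV by (rule inj_on_subset)
  have "hypergraph (f ` V) ((`) f ` E)"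
    using fV EV by (auto simp: hypergraph_def)
  moreover have "uniform n ((`) f ` E)"
    unfolding uniform_def
  proof
    fix e' assume "e' \<in> (`) f ` E"
    then obtain e where e: "e \<in> E" "e' = f ` e" by blast
    have "inj_on f e" using e(1) EV f by (meson Pow_iff inj_on_subset subsetD)
    then show "card e' = n"
      using e assms(2) by (simp add: card_image uniform_def)
  qed
  moreover have "\<not> colorable r (f ` V) ((`) f ` E)"
  proof
    assume "colorable r (f ` V) ((`) f ` E)"
    then obtain c :: "nat \<Rightarrow> nat" where
      c: "c ` f ` V \<subseteq> {1..r}" "\<forall>e\<in>(`) f ` E. card (c ` e) \<ge> 2"
      unfolding colorable_def by blast
    have "colorable r V E"
      unfolding colorable_def using c by (intro exI[of _ "c \<circ> f"]) (auto simp: image_comp)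
    then show False using assms(3) by blast
  qed
  moreover have "card ((`) f ` E) = card E"
    using inj by (rule card_image)
  ultimately show ?thesis
    unfolding min_edges_def by (intro Least_le) blast
qed

lemma min_edges_attained:
  assumes "r > 0"
  shows "\<exists>(V :: nat set) E. hypergraph V E \<and> uniform n E \<and> \<not> colorable r V E
           \<and> card E = min_edges n r"
proof -
  define V where "V = {..<r * n + 1}"
  define E where "E = {e. e \<subseteq> V \<and> card e = n}"
  have "\<not> colorable r V E"
  proof
    assume "colorable r V E"
    then obtain c :: "nat \<Rightarrow> nat" where
      c: "c ` V \<subseteq> {1..r}" "\<forall>e\<in>E. card (c ` e) \<ge> 2"
      unfolding colorable_def by blast
    have "\<exists>i\<in>{1..r}. card {v \<in> V. c v = i} \<ge> n"
    proof (rule ccontr)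
      assume "\<not> ?thesis"
      then have small: "\<forall>i\<in>{1..r}. card {v \<in> V. c v = i} \<le> n" by force
      have "V = (\<Union>i\<in>{1..r}. {v \<in> V. c v = i})" using c(1) by auto
      then have "card V \<le> (\<Sum>i\<in>{1..r}. card {v \<in> V. c v = i})"
        by (metis card_UN_le finite_atLeastAtMost)
      also have "\<dots> \<le> (\<Sum>i\<in>{1..r}. n)" by (rule sum_mono) (use small in blast)
      finally show False by (simp add: V_def)
    qed
    then obtain i where "card {v \<in> V. c v = i} \<ge> n" by blast
    then obtain e where e: "e \<subseteq> {v \<in> V. c v = i}" "card e = n"
      using obtain_subset_with_card_n by metis
    then have "e \<in> E" by (auto simp: E_def)
    moreover have "c ` e \<subseteq> {i}" using e(1) by auto
    then have "card (c ` e) \<le> 1" using card_mono[of "{i}" "c ` e"] by simp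
    ultimately show False using c(2) by fastforce
  qed
  moreover have "hypergraph V E" "uniform n E"
    by (auto simp: hypergraph_def uniform_def V_def E_def)
  ultimately have "\<exists>k. \<exists>(V :: nat set) E.
      hypergraph V E \<and> uniform n E \<and> \<not> colorable r V E \<and> card E = k"
    by blast
  then show ?thesis
    unfolding min_edges_def by (rule LeastI_ex)
qed

end

theory Submission
  imports Defs "HOL-Analysis.Convex" "HOL-Library.FuncSet" "HOL-Library.Disjoint_Sets"
begin

text \<open>
  Give the vertices independent uniform weights from \<open>{..<N}\<close> with \<open>N = r * n\<close> and order them by
  weight. If there is no ordered \<open>r\<close>-chain of edges (the last vertex of each edge being the first
  one of the next), then colouring a vertex by the length of the longest chain ending there is
  proper. With \<open>p \<approx> 2 ln n / n\<close>, call an edge short if its weights lie in a window of length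
  \<open>(1 - p) N / r\<close>. The expected number of short edges is at most
  \<open>N r\<^sup>-\<^sup>n (1 - p)\<^sup>n \<bar>E\<bar> \<le> r\<^sup>1\<^sup>-\<^sup>n \<bar>E\<bar> / n\<close>.
  In an ordered \<open>r\<close>-chain without short edges, each of the \<open>r - 1\<close> joints has its weight confined
  to a window of length \<open>p N\<close>; given the weights of the joints, the other vertices cost
  \<open>O(r\<^sup>-\<^sup>r\<^sup>n)\<close> by the inequality of arithmetic and geometric means. So the expected number of such
  chains is \<open>O((\<bar>E\<bar> r\<^sup>-\<^sup>n)\<^sup>r p\<^sup>r\<^sup>-\<^sup>1)\<close>, and both expectations are small
  if \<open>\<bar>E\<bar>\<close> is below the bound.
\<close>

section \<open>Ordered chains and proper colourings\<close>

definition ordered_chain :: "('a \<Rightarrow> nat) \<Rightarrow> 'a set list \<Rightarrow> bool" where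
  "ordered_chain k es \<longleftrightarrow> successively (\<lambda>e f. Max (k ` e) = Min (k ` f)) es"

text \<open>A longest chain ending at the first vertex of an edge \<open>e\<close>, with
  \<open>e\<close> appended, ends at the last vertex of \<open>e\<close>, so these two vertices get
  different colours. Chain lengths stay below \<open>r\<close>, which leaves \<open>r\<close>
  colours.\<close>

lemma colorable_if_no_ordered_chain:
  assumes "finite V" "E \<subseteq> Pow V" "{} \<notin> E"
    and no_chain: "\<And>es. set es \<subseteq> E \<Longrightarrow> length es = r \<Longrightarrow> \<not> ordered_chain k es"
  shows "colorable r V E"
proof -
  define P where "P v es \<longleftrightarrow> set es \<subseteq> E \<and> ordered_chain k es \<and> (es = [] \<or> Max (k ` last es) = k v)"
    for v es
  define S where "S v = length ` {es. P v es}" for v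
  have short: "length es < r" if "P v es" for v es
  proof (rule ccontr)
    assume "\<not> length es < r"
    \<comment> \<open>A prefix of an ordered chain is again one, so truncating to \<open>r\<close>
      edges reaches the case excluded by \<open>no_chain\<close>.\<close>
    then have len: "length (take r es) = r" by simp
    have "ordered_chain k (take r es @ drop r es)" using that by (simp add: P_def)
    then have "ordered_chain k (take r es)"
      unfolding ordered_chain_def successively_append_iff by blast
    moreover have "set (take r es) \<subseteq> E" using that set_take_subset[of r es] by (auto simp: P_def)
    ultimately show False using no_chain len by blast
  qed
  have sub: "S v \<subseteq> {..<r}" for v using short by (auto simp: S_def)
  then have fin: "finite (S v)" for v by (rule finite_subset) simp
  \<comment> \<open>The empty chain ends at every vertex by convention, so the maximum in
    \<open>c\<close> is over a nonempty set.\<close>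
  have "P v []" for v by (simp add: P_def ordered_chain_def)
  then have ne: "S v \<noteq> {}" for v by (auto simp: S_def)
  define c where "c v = Suc (Max (S v))" for v
  have "Max (S v) < r" for v using Max_in[OF fin ne, of v] sub[of v] by auto
  then have "c ` V \<subseteq> {1..r}" by (auto simp: c_def Suc_le_eq)
  moreover have "card (c ` e) \<ge> 2" if e: "e \<in> E" for e
  proof -
    have fe: "finite e" "e \<noteq> {}" using assms(1-3) e by (auto intro: finite_subset)
    obtain f where f: "f \<in> e" "k f = Min (k ` e)"
      using Min_in[of "k ` e"] fe by fastforce
    obtain l where l: "l \<in> e" "k l = Max (k ` e)"
      using Max_in[of "k ` e"] fe by fastforce
    obtain es where es: "P f es" "length es = Max (S f)"
      using Max_in[OF fin ne, of f] unfolding S_def by auto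
    have "P l (es @ [e])"
      using es(1) e f l by (auto simp: P_def ordered_chain_def successively_append_iff)
    then have "Suc (Max (S f)) \<in> S l" using es(2) unfolding S_def by force
    then have "c f < c l" using Max_ge[OF fin] by (force simp: c_def)
    then have "card {c f, c l} = 2" by auto
    then show ?thesis using card_mono[of "c ` e" "{c f, c l}"] fe f l by auto
  qed
  ultimately show ?thesis unfolding colorable_def by blast
qed

section \<open>Counting weightings with confined vertices\<close>

text \<open>Each factor is the probability that a uniform weight falls into \<open>A u\<close>. The
  events are independent, and those outside \<open>U\<close> are bounded by 1.\<close>

lemma card_PiE_le_prod:
  assumes "finite V" "U \<subseteq> V" "\<And>u. u \<in> V \<Longrightarrow> A u \<subseteq> {..<N}" "N > 0"
  shows "real (card (PiE V A)) \<le> (\<Prod>u\<in>U. real (card (A u)) / real N) * real N ^ card V"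
proof -
  have le: "real (card (A u)) / real N \<le> 1" if "u \<in> V" for u
    using card_mono[OF _ assms(3)[OF that]] assms(4) by (simp add: field_simps)
  have "real (card (PiE V A)) = (\<Prod>u\<in>V. real (card (A u)) / real N) * real N ^ card V"
    using assms(1,4) by (simp add: card_PiE prod_dividef)
  also have "(\<Prod>u\<in>V. real (card (A u)) / real N) \<le> (\<Prod>u\<in>U. real (card (A u)) / real N)"
  proof -
    have "(\<Prod>u\<in>V. real (card (A u)) / real N) =
      (\<Prod>u\<in>V - U. real (card (A u)) / real N) * (\<Prod>u\<in>U. real (card (A u)) / real N)"
      using prod.subset_diff[OF assms(2,1)] .
    also have "\<dots> \<le> 1 * (\<Prod>u\<in>U. real (card (A u)) / real N)"
      by (intro mult_right_mono prod_le_1 prod_nonneg) (use le in auto)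
    finally show ?thesis by simp
  qed
  finally show ?thesis by (simp add: mult_right_mono)
qed

lemma prod_le_mean_power:
  fixes d :: "nat \<Rightarrow> real"
  assumes "r > 0" "\<And>i. i < r \<Longrightarrow> d i \<ge> 0"
  shows "(\<Prod>i<r. d i) \<le> ((\<Sum>i<r. d i) / r) ^ r"
proof -
  have root: "p = (p powr (1 / r)) ^ r" if "p \<ge> 0" for p :: real
    using assms(1) that by (cases "p = 0") (auto simp: powr_power)
  have "(\<Prod>i<r. d i) \<ge> 0" using assms by (intro prod_nonneg) auto
  then have "(\<Prod>i<r. d i) = ((\<Prod>i<r. d i) powr (1 / r)) ^ r" by (rule root)
  also have "\<dots> \<le> ((\<Sum>i<r. d i) / r) ^ r"
    using arith_geom_mean[of "{..<r}" d] assms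
    by (intro power_mono) (auto simp: sum_divide_distrib)
  finally show ?thesis .
qed

text \<open>With the two ends of the range of weights added to the weights of the joints, the
  \<open>i\<close>-th edge of a chain has its weights between the \<open>i\<close>-th and the next entry, also for the
  first and the last edge.\<close>

definition extend :: "nat \<Rightarrow> nat \<Rightarrow> (nat \<Rightarrow> nat) \<Rightarrow> nat \<Rightarrow> nat" where
  "extend N r x i = (if i = 0 then 0 else if i = r then N - 1 else x i)"

lemma gaps_le:
  fixes y :: "nat \<Rightarrow> nat"
  assumes "\<And>i. i < r \<Longrightarrow> y i + L \<le> y (Suc i)" "i \<le> j" "j \<le> r"
  shows "y i + (j - i) * L \<le> y j"
  using assms(2,3)
proof (induction j rule: dec_induct)
  case (step j)
  then show ?case using assms(1)[of j] by (simp add: Suc_diff_le)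
qed simp

text \<open>Split \<open>W\<close> by the weights \<open>x\<close> of the joints \<open>v\<close>.
  At most \<open>(N - r * L) ^ (r - 1)\<close> choices of \<open>x\<close> occur. For each, a joint
  costs a factor \<open>1 / N\<close> and a vertex of \<open>B i\<close> the proportion
  \<open>d i\<close> of weights in its window. The \<open>d i\<close> sum to at most
  \<open>1 + r / N\<close>, so AM-GM bounds their product.\<close>

lemma card_weights_le:
  fixes V :: "'a set"
  assumes fV: "finite V" and vV: "v ` {1..<r} \<subseteq> V" and inj: "inj_on v {1..<r}"
    and BV: "\<And>i. i < r \<Longrightarrow> B i \<subseteq> V" and disj: "disjoint_family_on B {..<r}"
    and vB: "\<And>i j. i < r \<Longrightarrow> j \<in> {1..<r} \<Longrightarrow> v j \<notin> B i"
    and cB: "\<And>i. i < r \<Longrightarrow> m \<le> card (B i)" and N: "N > 0" and r: "r > 0"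
    and W: "\<And>w. w \<in> W \<Longrightarrow> w \<in> V \<rightarrow>\<^sub>E {..<N}"
    and gap: "\<And>w i. w \<in> W \<Longrightarrow> i < r \<Longrightarrow>
      extend N r (w \<circ> v) i + L \<le> extend N r (w \<circ> v) (Suc i)"
    and mid: "\<And>w i u. w \<in> W \<Longrightarrow> i < r \<Longrightarrow> u \<in> B i \<Longrightarrow>
      w u \<in> {extend N r (w \<circ> v) i..extend N r (w \<circ> v) (Suc i)}"
  shows "real (card W) \<le> (real (N - r * L) / N) ^ (r - 1) * ((real N + r) / (r * real N)) ^ (r * m)
    * real N ^ card V"
proof -
  define X where "X = {x \<in> {1..<r} \<rightarrow>\<^sub>E {..<N}. \<forall>i<r. extend N r x i + L \<le> extend N r x (Suc i)}"
  define A where "A x u = {y \<in> {..<N}. (\<forall>i\<in>{1..<r}. u = v i \<longrightarrow> y = x i) \<and>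
    (\<forall>i<r. u \<in> B i \<longrightarrow> y \<in> {extend N r x i..extend N r x (Suc i)})}" for x u
  define b where "b = (1 / real N) ^ (r - 1) * ((real N + r) / (r * real N)) ^ (r * m)
    * real N ^ card V"
  have fX: "finite X"
    by (rule finite_subset[of _ "{1..<r} \<rightarrow>\<^sub>E {..<N}"]) (auto simp: X_def intro!: finite_PiE)
  \<comment> \<open>Joint \<open>i\<close> has \<open>i\<close> gaps of size \<open>L\<close> below
    it and \<open>r - i\<close> above it, which leaves it \<open>N - r * L\<close>
    positions.\<close>
  have "X \<subseteq> PiE {1..<r} (\<lambda>i. {i * L..<i * L + (N - r * L)})"
  proof
    fix x assume x: "x \<in> X"
    have "x i \<in> {i * L..<i * L + (N - r * L)}" if i: "i \<in> {1..<r}" for i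
    proof -
      have g: "\<And>i. i < r \<Longrightarrow> extend N r x i + L \<le> extend N r x (Suc i)"
        using x by (auto simp: X_def)
      have "i * L \<le> x i" using gaps_le[of r "extend N r x" L 0 i, OF g] i by (auto simp: extend_def)
      moreover have "x i + (r - i) * L \<le> N - 1"
        using gaps_le[of r "extend N r x" L i r, OF g] i by (auto simp: extend_def)
      moreover have "r * L = i * L + (r - i) * L"
        using i by (metis add_mult_distrib atLeastLessThan_iff le_add_diff_inverse less_imp_le)
      ultimately show ?thesis using N by auto
    qed
    then show "x \<in> PiE {1..<r} (\<lambda>i. {i * L..<i * L + (N - r * L)})"
      using x by (auto simp: X_def PiE_iff)
  qed
  then have "card X \<le> card (PiE {1..<r} (\<lambda>i. {i * L..<i * L + (N - r * L)}))"
    by (intro card_mono finite_PiE) auto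
  also have "\<dots> = (N - r * L) ^ (r - 1)" by (simp add: card_PiE)
  finally have cX: "card X \<le> (N - r * L) ^ (r - 1)" .
  have cPi: "real (card (PiE V (A x))) \<le> b" if x: "x \<in> X" for x
  proof -
    define y where "y = extend N r x"
    have ymono: "y i \<le> y (Suc i)" if "i < r" for i using x that by (auto simp: X_def y_def)
    define d where "d i = real (card ({..<N} \<inter> {y i..y (Suc i)})) / N" for i
    have d01: "0 \<le> d i" "d i \<le> 1" for i
      using card_mono[of "{..<N}" "{..<N} \<inter> {y i..y (Suc i)}"] N by (auto simp: d_def field_simps)
    define U where "U = v ` {1..<r} \<union> (\<Union>i<r. B i)"
    have UV: "U \<subseteq> V" using vV BV by (auto simp: U_def)
    have fB: "finite (B i)" if "i < r" for i using BV[OF that] fV by (rule finite_subset)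
    let ?q = "\<lambda>u. real (card (A x u)) / N"
    have q1: "?q (v i) \<le> 1 / N" if "i \<in> {1..<r}" for i
    proof -
      have "A x (v i) \<subseteq> {x i}" using that by (auto simp: A_def)
      then have "card (A x (v i)) \<le> 1" using card_mono[of "{x i}" "A x (v i)"] by simp
      then show ?thesis using N by (simp add: field_simps)
    qed
    have q2: "?q u \<le> d i" if "i < r" "u \<in> B i" for i u
      unfolding d_def using that by (intro divide_right_mono) (auto simp: A_def y_def intro!: card_mono)
    have "(\<Prod>u\<in>U. ?q u) = (\<Prod>u\<in>v ` {1..<r}. ?q u) * (\<Prod>u\<in>(\<Union>i<r. B i). ?q u)"
      unfolding U_def using vB fB by (intro prod.union_disjoint) auto
    also have "(\<Prod>u\<in>v ` {1..<r}. ?q u) = (\<Prod>i\<in>{1..<r}. ?q (v i))"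
      using inj by (simp add: prod.reindex)
    also have "(\<Prod>u\<in>(\<Union>i<r. B i). ?q u) = (\<Prod>i<r. \<Prod>u\<in>B i. ?q u)"
      using disj fB by (intro prod.UNION_disjoint) (auto simp: disjoint_family_on_def)
    also have "(\<Prod>i\<in>{1..<r}. ?q (v i)) * (\<Prod>i<r. \<Prod>u\<in>B i. ?q u)
      \<le> (\<Prod>i\<in>{1..<r}. 1 / real N) * (\<Prod>i<r. \<Prod>u\<in>B i. d i)"
      by (intro mult_mono prod_mono prod_nonneg conjI q1 q2) (use d01 in auto)
    \<comment> \<open>As \<open>d i\<close> is at most 1, lowering the exponent from
      \<open>card (B i)\<close> to \<open>m\<close> only increases the power.\<close>
    also have "\<dots> \<le> (1 / real N) ^ (r - 1) * (\<Prod>i<r. d i ^ m)"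
      using d01 cB by (auto intro!: mult_mono prod_mono power_decreasing prod_nonneg)
    also have "(\<Prod>i<r. d i ^ m) = (\<Prod>i<r. d i) ^ m" by (simp add: prod_power_distrib)
    also have "\<dots> \<le> (((real N + r) / (r * real N)) ^ r) ^ m"
    proof (intro power_mono prod_nonneg)
      \<comment> \<open>The windows are closed and share endpoints, so each contributes its length
        plus one. The lengths telescope to \<open>N - 1\<close>.\<close>
      have "(\<Sum>i<r. d i) \<le> (\<Sum>i<r. (real (y (Suc i)) - y i + 1) / N)"
      proof (intro sum_mono)
        fix i assume "i \<in> {..<r}"
        moreover have "card ({..<N} \<inter> {y i..y (Suc i)}) \<le> card {y i..y (Suc i)}"
          by (intro card_mono) auto
        ultimately show "d i \<le> (real (y (Suc i)) - y i + 1) / N"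
          unfolding d_def using ymono[of i] by (intro divide_right_mono) auto
      qed
      also have "\<dots> = (\<Sum>i<r. real (y (Suc i)) - y i + 1) / N" by (simp add: sum_divide_distrib)
      also have "(\<Sum>i<r. real (y (Suc i)) - y i + 1) = real (y r) - y 0 + r"
        using sum_lessThan_telescope[of "\<lambda>i. real (y i)" r] by (simp add: sum.distrib)
      also have "\<dots> \<le> real N + r" by (simp add: y_def extend_def)
      finally have s: "(\<Sum>i<r. d i) \<le> (real N + r) / N" by (simp add: divide_right_mono)
      have "(\<Prod>i<r. d i) \<le> ((\<Sum>i<r. d i) / r) ^ r" using prod_le_mean_power r d01 by simp
      also have "\<dots> \<le> (((real N + r) / N) / r) ^ r"
        using s d01 by (intro power_mono divide_right_mono divide_nonneg_nonneg sum_nonneg) auto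
      finally show "(\<Prod>i<r. d i) \<le> ((real N + r) / (r * real N)) ^ r"
        by (simp add: mult.commute)
    qed (use d01 in auto)
    finally have "(\<Prod>u\<in>U. ?q u) \<le> (1 / real N) ^ (r - 1) * ((real N + r) / (r * real N)) ^ (r * m)"
      by (simp add: mult_left_mono power_mult)
    then have "(\<Prod>u\<in>U. ?q u) * real N ^ card V \<le> b"
      unfolding b_def by (intro mult_right_mono) auto
    moreover have "real (card (PiE V (A x))) \<le> (\<Prod>u\<in>U. ?q u) * real N ^ card V"
      by (rule card_PiE_le_prod[OF fV UV _ N]) (auto simp: A_def)
    ultimately show ?thesis by linarith
  qed
  have "W \<subseteq> (\<Union>x\<in>X. PiE V (A x))"
  proof
    fix w assume w: "w \<in> W"
    define x where "x = restrict (w \<circ> v) {1..<r}"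
    have ext: "extend N r x i = extend N r (w \<circ> v) i" if "i \<le> r" for i
      using that by (auto simp: extend_def x_def)
    have "w (v i) < N" if "i \<in> {1..<r}" for i using PiE_mem[OF W[OF w], of "v i"] vV imageI[OF that, of v] by auto
    then have "x \<in> X"
      using gap[OF w] by (auto simp: X_def ext) (auto simp: x_def)
    moreover have "w \<in> PiE V (A x)"
    proof (rule PiE_I)
      fix u assume u: "u \<in> V"
      have "w u < N" using W[OF w] u by auto
      then show "w u \<in> A x u"
        using mid[OF w] by (auto simp: A_def ext) (auto simp: x_def)
    qed (use W[OF w] in auto)
    ultimately show "w \<in> (\<Union>x\<in>X. PiE V (A x))" by blast
  qed
  then have "card W \<le> card (\<Union>x\<in>X. PiE V (A x))"
    using fX fV by (intro card_mono finite_UN_I finite_PiE) (auto simp: A_def)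
  also have "\<dots> \<le> (\<Sum>x\<in>X. card (PiE V (A x)))" by (rule card_UN_le[OF fX])
  finally have "real (card W) \<le> (\<Sum>x\<in>X. real (card (PiE V (A x))))"
    by (simp only: of_nat_sum[symmetric] of_nat_le_iff)
  also have "\<dots> \<le> real (card X) * b" using cPi by (rule sum_bounded_above)
  also have "\<dots> \<le> real ((N - r * L) ^ (r - 1)) * b"
    using cX by (intro mult_right_mono) (auto simp: b_def simp del: of_nat_power)
  finally show ?thesis by (simp add: b_def power_divide mult.assoc)
qed

section \<open>The combinatorics of ordered chains\<close>

text \<open>In an ordered chain, consecutive edges meet in exactly one vertex, so the joints depend on the
  chain alone and not on the weights. \<open>joint es 0\<close> and \<open>joint es (length es)\<close> are junk values;
  removing them in \<open>interior\<close> as well only costs a constant factor, and gives all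
  interiors the same lower bound \<open>n - 2\<close> on their size.\<close>

definition joint :: "'a set list \<Rightarrow> nat \<Rightarrow> 'a" where
  "joint es i = the_elem (es ! (i - 1) \<inter> es ! i)"

definition interior :: "'a set list \<Rightarrow> nat \<Rightarrow> 'a set" where
  "interior es i = es ! i - {joint es i, joint es (Suc i)}"

text \<open>An edge has two vertices with distinct keys, so its minimum \<open>mn i\<close> lies
  below its maximum \<open>mx i\<close>, which is the minimum of the next edge. Hence the minima
  increase strictly along the chain, and a vertex common to two edges forces them to be consecutive
  and is their joint.\<close>

lemma ordered_chain_joints:
  assumes inj: "inj_on k V" and fV: "finite V"
    and es: "\<forall>e\<in>set es. e \<subseteq> V \<and> 2 \<le> card e"
    and chain: "ordered_chain k es"
  shows "i \<in> {1..<length es} \<Longrightarrow> joint es i \<in> es ! (i - 1) \<inter> es ! i"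
    and "i \<in> {1..<length es} \<Longrightarrow> u \<in> es ! (i - 1) \<Longrightarrow> k u \<le> k (joint es i)"
    and "i \<in> {1..<length es} \<Longrightarrow> u \<in> es ! i \<Longrightarrow> k (joint es i) \<le> k u"
    and "inj_on (joint es) {1..<length es}"
    and "disjoint_family_on (interior es) {..<length es}"
    and "i < length es \<Longrightarrow> j \<in> {1..<length es} \<Longrightarrow> joint es j \<notin> interior es i"
proof -
  define r where "r = length es"
  define mx where "mx i = Max (k ` (es ! i))" for i
  define mn where "mn i = Min (k ` (es ! i))" for i
  have sub: "es ! i \<subseteq> V" "finite (es ! i)" "2 \<le> card (es ! i)" if "i < r" for i
    using es that finite_subset[OF _ fV, of "es ! i"] by (auto simp: r_def)
  have bnd: "mn i \<le> k u" "k u \<le> mx i" if "i < r" "u \<in> es ! i" for i u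
    using that sub[of i] by (auto simp: mn_def mx_def)
  have link: "mx i = mn (Suc i)" if "Suc i < r" for i
    using chain that by (simp add: ordered_chain_def successively_conv_nth mx_def mn_def r_def)
  have "mn i < mx i" if i: "i < r" for i
  proof -
    obtain a b where "a \<in> es ! i" "b \<in> es ! i" "a \<noteq> b"
      using sub(2,3)[OF i] card_le_Suc0_iff_eq[of "es ! i"] by fastforce
    moreover have "k a \<noteq> k b" using calculation inj sub(1)[OF i] by (meson inj_onD subsetD)
    ultimately show ?thesis using bnd[OF i, of a] bnd[OF i, of b] by linarith
  qed
  then have step: "mn i < mn (Suc i)" if "Suc i < r" for i
    by (metis that link Suc_lessD)
  have mono: "mn i < mn j" if "i < j" "j < r" for i j
    using that
  proof (induction j)
    case (Suc j)
    then show ?case using step[of j] by (cases "i = j") auto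
  qed simp
  have J: "joint es i \<in> es ! (i - 1) \<inter> es ! i \<and> k (joint es i) = mn i
      \<and> es ! (i - 1) \<inter> es ! i = {joint es i}" if i: "i \<in> {1..<r}" for i
  proof -
    have i': "i - 1 < r" "i < r" "Suc (i - 1) = i" using i by auto
    have l: "mx (i - 1) = mn i" using link[of "i - 1"] i' by simp
    obtain a where a: "a \<in> es ! (i - 1)" "k a = mx (i - 1)"
      using Max_in[of "k ` (es ! (i - 1))"] sub[OF i'(1)] unfolding mx_def by fastforce
    obtain b where b: "b \<in> es ! i" "k b = mn i"
      using Min_in[of "k ` (es ! i)"] sub[OF i'(2)] unfolding mn_def by fastforce
    have aV: "a \<in> V" and bV: "b \<in> V" using a(1) b(1) sub(1) i' by blast+
    have uq: "u = a" if "u \<in> es ! (i - 1)" "u \<in> es ! i" for u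
    proof -
      have "k u = k a"
        using bnd(2)[OF i'(1) that(1)] bnd(1)[OF i'(2) that(2)] a(2) l by linarith
      moreover have "u \<in> V" using that(2) sub(1)[OF i'(2)] by blast
      ultimately show ?thesis using inj_onD[OF inj] aV by blast
    qed
    have "b = a" using inj_onD[OF inj _ bV aV] a(2) b(2) l by simp
    then have "a \<in> es ! i" using b(1) by simp
    then have "es ! (i - 1) \<inter> es ! i = {a}" using a(1) uq by blast
    then show ?thesis using a l by (simp add: joint_def)
  qed
  have far: "j = Suc i" "u = joint es j" if "i < j" "j < r" "u \<in> es ! i" "u \<in> es ! j" for i j u
  proof -
    have "mn j \<le> mx i" using bnd[of i u] bnd[of j u] that by auto
    then show "j = Suc i" using mono[of "Suc i" j] link[of i] that by (cases "Suc i = j") auto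
    then show "u = joint es j" using J[of j] that by auto
  qed
  show "joint es i \<in> es ! (i - 1) \<inter> es ! i" if "i \<in> {1..<length es}"
    using J that by (simp add: r_def)
  show "k u \<le> k (joint es i)" if "i \<in> {1..<length es}" "u \<in> es ! (i - 1)"
    using J[of i] bnd(2)[of "i - 1" u] link[of "i - 1"] that by (auto simp: r_def)
  show "k (joint es i) \<le> k u" if "i \<in> {1..<length es}" "u \<in> es ! i"
    using J[of i] bnd(1)[of i u] that by (auto simp: r_def)
  show "inj_on (joint es) {1..<length es}"
  proof (rule inj_onI)
    fix i j assume "i \<in> {1..<length es}" "j \<in> {1..<length es}" "joint es i = joint es j"
    then show "i = j"
      using J[of i] J[of j] mono[of i j] mono[of j i] by (auto simp: r_def) (metis linorder_cases less_irrefl)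
  qed
  have disj: "interior es i \<inter> interior es j = {}" if "i < j" "j < r" for i j
    using far[OF that] by (auto simp: interior_def)
  show "disjoint_family_on (interior es) {..<length es}"
    unfolding disjoint_family_on_def using disj r_def
    by (metis Int_commute lessThan_iff linorder_cases)
  show "joint es j \<notin> interior es i" if "i < length es" "j \<in> {1..<length es}"
  proof
    assume "joint es j \<in> interior es i"
    then have *: "joint es j \<in> es ! i" "j \<noteq> i" "j \<noteq> Suc i" by (auto simp: interior_def)
    have j: "joint es j \<in> es ! j" "joint es j \<in> es ! (j - 1)" "j < r" "j \<ge> 1"
      using J[of j] that by (auto simp: r_def)
    \<comment> \<open>Joint \<open>j\<close> lies in the edges \<open>j - 1\<close> and
      \<open>j\<close>. Comparing edge \<open>i\<close> with edge \<open>j\<close> if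
      \<open>i < j\<close>, and with edge \<open>j - 1\<close> otherwise, \<open>far\<close> gives
      \<open>j = Suc i\<close> or \<open>j = i\<close>.\<close>
    show False
    proof (cases "i < j")
      case True
      then show False using far(1)[of i j "joint es j"] * j by auto
    next
      case False
      then have "j - 1 < i" using j(4) by linarith
      then show False using far(1)[of "j - 1" i "joint es j"] * j that by (auto simp: r_def)
    qed
  qed
qed

section \<open>Short edges\<close>

text \<open>For a nonempty finite edge the negation is being short: all weights lie among
  \<open>L\<close> consecutive integers.\<close>

definition spread :: "nat \<Rightarrow> ('a \<Rightarrow> nat) \<Rightarrow> 'a set \<Rightarrow> bool" where
  "spread L w e \<longleftrightarrow> (\<exists>u\<in>e. \<exists>u'\<in>e. w u + L \<le> w u')"

text \<open>A union bound over the least weight \<open>a\<close> on \<open>e\<close> gives the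
  factor \<open>N\<close>. Given \<open>a\<close>, each vertex of \<open>e\<close> has at most
  \<open>L\<close> possible weights.\<close>

lemma card_not_spread_le:
  assumes fV: "finite V" and e: "e \<subseteq> V" "e \<noteq> {}" and N: "N > 0"
  shows "real (card {w \<in> V \<rightarrow>\<^sub>E {..<N}. \<not> spread L w e})
    \<le> real N * (real L / N) ^ card e * real N ^ card V"
proof -
  define A where "A a u = (if u \<in> e then {a..<a + L} \<inter> {..<N} else {..<N})" for a u
  have fe: "finite e" using fV e finite_subset by blast
  have "{w \<in> V \<rightarrow>\<^sub>E {..<N}. \<not> spread L w e} \<subseteq> (\<Union>a<N. PiE V (A a))"
  proof
    fix w assume "w \<in> {w \<in> V \<rightarrow>\<^sub>E {..<N}. \<not> spread L w e}"
    then have w: "w \<in> V \<rightarrow>\<^sub>E {..<N}" and ns: "\<not> spread L w e" by auto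
    obtain u where u: "u \<in> e" "w u = Min (w ` e)" using Min_in[of "w ` e"] fe e by fastforce
    have "w \<in> PiE V (A (w u))"
      using w ns u fe unfolding A_def PiE_iff spread_def by (auto simp: not_le)
    moreover have "w u < N" using PiE_mem[OF w, of u] u(1) e(1) by auto
    ultimately show "w \<in> (\<Union>a<N. PiE V (A a))" by blast
  qed
  then have "card {w \<in> V \<rightarrow>\<^sub>E {..<N}. \<not> spread L w e} \<le> card (\<Union>a<N. PiE V (A a))"
    using fV by (intro card_mono finite_UN_I finite_PiE) (auto simp: A_def)
  also have "\<dots> \<le> (\<Sum>a<N. card (PiE V (A a)))" by (rule card_UN_le) simp
  finally have "real (card {w \<in> V \<rightarrow>\<^sub>E {..<N}. \<not> spread L w e})
      \<le> (\<Sum>a<N. real (card (PiE V (A a))))"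
    by (simp only: of_nat_sum[symmetric] of_nat_le_iff)
  also have "\<dots> \<le> (\<Sum>a<N. (real L / N) ^ card e * real N ^ card V)"
  proof (rule sum_mono)
    fix a
    have "real (card (PiE V (A a))) \<le> (\<Prod>u\<in>e. real (card (A a u)) / real N) * real N ^ card V"
      by (rule card_PiE_le_prod[OF fV e(1) _ N]) (auto simp: A_def)
    also have "(\<Prod>u\<in>e. real (card (A a u)) / real N) \<le> (\<Prod>u\<in>e. real L / real N)"
    proof (intro prod_mono conjI divide_right_mono)
      fix u assume "u \<in> e"
      then show "real (card (A a u)) \<le> real L"
        using card_mono[of "{a..<a + L}" "{a..<a + L} \<inter> {..<N}"] by (simp add: A_def)
    qed auto
    finally show "real (card (PiE V (A a))) \<le> (real L / N) ^ card e * real N ^ card V"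
      by (simp add: mult_right_mono)
  qed
  finally show ?thesis by (simp add: mult.assoc)
qed

section \<open>Weightings that order a given chain\<close>

text \<open>Ordering the vertices by \<open>key\<close> is ordering them by weight, with ties broken by the vertex
  itself (a natural number below \<open>M\<close>).\<close>

definition key :: "nat \<Rightarrow> (nat \<Rightarrow> nat) \<Rightarrow> nat \<Rightarrow> nat" where
  "key M w v = w v * M + v"

lemma key_le_imp_le: "key M w u \<le> key M w v \<Longrightarrow> v < M \<Longrightarrow> w u \<le> w v"
  unfolding key_def
proof (rule ccontr)
  assume *: "w u * M + u \<le> w v * M + v" "v < M" "\<not> w u \<le> w v"
  then have "Suc (w v) * M \<le> w u * M" by (intro mult_right_mono) auto
  then show False using * by simp
qed

lemma inj_on_key: "inj_on (key M w) {..<M}"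
proof (rule inj_onI)
  fix u v assume *: "u \<in> {..<M}" "v \<in> {..<M}" "key M w u = key M w v"
  then have "w u = w v" using key_le_imp_le[of M w u v] key_le_imp_le[of M w v u] by simp
  then show "u = v" using * by (simp add: key_def)
qed

text \<open>Comparing keys yields weak inequalities of weights, so each edge has its weights between
  consecutive entries of the extended joint weights. Being spread then makes these entries differ by
  at least \<open>L\<close>.\<close>

lemma card_chain_weights_le:
  fixes V :: "nat set"
  assumes VM: "V \<subseteq> {..<M}" and es: "\<And>e. e \<in> set es \<Longrightarrow> e \<subseteq> V \<and> card e = n"
    and n: "n \<ge> 2" and len: "length es = r" and N: "N > 0" and r: "r > 0"
  shows "real (card {w \<in> V \<rightarrow>\<^sub>E {..<N}. ordered_chain (key M w) es \<and> (\<forall>e\<in>set es. spread L w e)})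
    \<le> (real (N - r * L) / N) ^ (r - 1) * ((real N + r) / (r * real N)) ^ (r * (n - 2))
    * real N ^ card V" (is "real (card ?W) \<le> ?R")
proof (cases "?W = {}")
  case True
  show ?thesis unfolding True by simp
next
  case False
  have fV: "finite V" using VM finite_subset by blast
  have es': "\<forall>e\<in>set es. e \<subseteq> V \<and> 2 \<le> card e" using es n by simp
  have injk: "inj_on (key M w) V" for w using inj_on_key VM by (rule inj_on_subset)
  note J = ordered_chain_joints[OF injk fV es', unfolded len]
  \<comment> \<open>One weighting suffices for the facts about joints and interiors that do not
    mention the weights.\<close>
  obtain w0 where "ordered_chain (key M w0) es" using False by blast
  note J0 = J[OF this]
  have sub: "es ! i \<subseteq> V" "card (es ! i) = n" if "i < r" for i
    using es[of "es ! i"] that len by auto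
  have bounds: "extend N r (w \<circ> joint es) i \<le> w u" "w u \<le> extend N r (w \<circ> joint es) (Suc i)"
    if w: "w \<in> ?W" and i: "i < r" and u: "u \<in> es ! i" for w i u
  proof -
    have c: "ordered_chain (key M w) es" and wN: "w \<in> V \<rightarrow>\<^sub>E {..<N}" using w by auto
    have uV: "u \<in> V" using sub i u by auto
    have jM: "joint es j < M" if "j \<in> {1..<r}" for j
      using J0(1)[OF that] sub(1)[of j] that VM by auto
    show "extend N r (w \<circ> joint es) i \<le> w u"
      using J(3)[OF c, of i u] key_le_imp_le[of M w "joint es i" u] i u uV VM
      by (auto simp: extend_def)
    have "w u < N" using wN uV by auto
    then show "w u \<le> extend N r (w \<circ> joint es) (Suc i)"
      using J(2)[OF c, of "Suc i" u] key_le_imp_le[of M w u "joint es (Suc i)"] i u jM[of "Suc i"]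
      by (auto simp: extend_def)
  qed
  show ?thesis
  proof (rule card_weights_le[where v = "joint es" and B = "interior es"])
    show "joint es ` {1..<r} \<subseteq> V" using J0(1) sub(1) by fastforce
    show "inj_on (joint es) {1..<r}" by (rule J0(4))
    show "disjoint_family_on (interior es) {..<r}" by (rule J0(5))
    show "interior es i \<subseteq> V" if "i < r" for i using sub(1)[OF that] by (auto simp: interior_def)
    show "joint es j \<notin> interior es i" if "i < r" "j \<in> {1..<r}" for i j
      by (rule J0(6)) (use that in auto)
    show "n - 2 \<le> card (interior es i)" if "i < r" for i
    proof -
      have "card {joint es i, joint es (Suc i)} \<le> 2" by (simp add: card_insert_if)
      then show ?thesis
        using diff_card_le_card_Diff[of "{joint es i, joint es (Suc i)}" "es ! i"] sub(2)[OF that]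
        unfolding interior_def by simp
    qed
    show "w u \<in> {extend N r (w \<circ> joint es) i..extend N r (w \<circ> joint es) (Suc i)}"
      if "w \<in> ?W" "i < r" "u \<in> interior es i" for w i u
      using bounds[OF that(1,2), of u] that(3) by (simp add: interior_def)
    show "extend N r (w \<circ> joint es) i + L \<le> extend N r (w \<circ> joint es) (Suc i)"
      if w: "w \<in> ?W" and i: "i < r" for w i
    proof -
      have "spread L w (es ! i)" using w i len by auto
      then obtain u u' where "u \<in> es ! i" "u' \<in> es ! i" "w u + L \<le> w u'" by (auto simp: spread_def)
      then show ?thesis using bounds(1)[OF w i, of u] bounds(2)[OF w i, of u'] by linarith
    qed
  qed (use fV N r in auto)
qed

section \<open>The union bound\<close>

text \<open>Every weighting has a short edge or an ordered \<open>r\<close>-chain of spread edges.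
  Counting both kinds and dividing by the number \<open>N ^ card V\<close> of weightings gives the
  two terms.\<close>

lemma not_colorable_imp_ge_1:
  fixes V :: "nat set"
  assumes H: "hypergraph V E" "uniform n E" "\<not> colorable r V E"
    and n: "n \<ge> 2" and N: "N > 0" and r: "r > 0"
  shows "1 \<le> real (card E) * (real N * (real L / N) ^ n)
    + real (card E) ^ r * ((real (N - r * L) / N) ^ (r - 1)
      * ((real N + r) / (r * real N)) ^ (r * (n - 2)))" (is "1 \<le> _ * ?p + _ * ?q")
proof -
  have fV: "finite V" and EV: "E \<subseteq> Pow V" and cE: "\<And>e. e \<in> E \<Longrightarrow> card e = n"
    using H by (auto simp: hypergraph_def uniform_def)
  have fE: "finite E" using fV EV finite_subset by blast
  obtain M where VM: "V \<subseteq> {..<M}" using fV finite_nat_iff_bounded by blast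
  have E0: "{} \<notin> E" using cE n by force
  define \<Omega> where "\<Omega> = V \<rightarrow>\<^sub>E {..<N}"
  define T where "T e = {w \<in> \<Omega>. \<not> spread L w e}" for e
  define C where "C es = {w \<in> \<Omega>. ordered_chain (key M w) es \<and> (\<forall>e\<in>set es. spread L w e)}" for es
  define X where "X = {es. set es \<subseteq> E \<and> length es = r}"
  have fX: "finite X" and cX: "card X = card E ^ r"
    using fE by (auto simp: X_def finite_lists_length_eq card_lists_length_eq)
  have "\<Omega> \<subseteq> (\<Union>e\<in>E. T e) \<union> (\<Union>es\<in>X. C es)"
  proof
    fix w assume w: "w \<in> \<Omega>"
    obtain es where es: "set es \<subseteq> E" "length es = r" "ordered_chain (key M w) es"
      using colorable_if_no_ordered_chain[OF fV EV E0] H(3) by blast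
    show "w \<in> (\<Union>e\<in>E. T e) \<union> (\<Union>es\<in>X. C es)"
    proof (cases "\<forall>e\<in>set es. spread L w e")
      case True
      then have "w \<in> C es" "es \<in> X" using w es by (auto simp: C_def X_def)
      then show ?thesis by blast
    next
      case False
      then show ?thesis using w es by (auto simp: T_def)
    qed
  qed
  moreover have f\<Omega>: "finite \<Omega>" using fV by (auto simp: \<Omega>_def intro!: finite_PiE)
  ultimately have "card \<Omega> \<le> card ((\<Union>e\<in>E. T e) \<union> (\<Union>es\<in>X. C es))"
    using fE fX by (intro card_mono) (auto simp: T_def C_def)
  also have "\<dots> \<le> (\<Sum>e\<in>E. card (T e)) + (\<Sum>es\<in>X. card (C es))"
    by (intro order_trans[OF card_Un_le] add_mono card_UN_le fE fX)
  finally have "real (card \<Omega>) \<le> (\<Sum>e\<in>E. real (card (T e))) + (\<Sum>es\<in>X. real (card (C es)))"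
    by (simp only: of_nat_sum[symmetric] of_nat_add[symmetric] of_nat_le_iff)
  also have "(\<Sum>e\<in>E. real (card (T e))) \<le> real (card E) * (?p * real N ^ card V)"
  proof (rule sum_bounded_above)
    fix e assume "e \<in> E"
    then show "real (card (T e)) \<le> ?p * real N ^ card V"
      using card_not_spread_le[OF fV _ _ N, of e L] cE EV E0 unfolding T_def \<Omega>_def by auto
  qed
  also have "(\<Sum>es\<in>X. real (card (C es))) \<le> real (card X) * (?q * real N ^ card V)"
  proof (rule sum_bounded_above)
    fix es assume "es \<in> X"
    then show "real (card (C es)) \<le> ?q * real N ^ card V"
      unfolding C_def \<Omega>_def using cE EV
      by (intro card_chain_weights_le[OF VM _ n _ N r]) (auto simp: X_def)
  qed
  also have "card \<Omega> = N ^ card V" using fV by (simp add: \<Omega>_def card_funcsetE)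
  finally have "1 * real N ^ card V \<le> (real (card E) * ?p + real (card E) ^ r * ?q) * real N ^ card V"
    by (simp add: cX algebra_simps)
  then show ?thesis using N by (simp only: mult_le_cancel_right) auto
qed

section \<open>Choice of parameters and asymptotics\<close>

theorem theorem2:
  fixes r :: nat
  assumes "r \<ge> 2"
  shows "\<exists>C > (0::real). \<exists>n0 :: nat. \<forall>n \<ge> n0.
    real (min_edges n r) \<ge> C * (real n / ln (real n)) powr ((real r - 1) / real r) * real r ^ n"
\<comment> \<open>The constant makes \<open>9 * C * r^2\<close> equal to 1/2, the base of the final
  power bounding the chain term. From 3 on, \<open>ln n\<close> is at least 1.\<close>
proof (intro exI[of _ "1 / (18 * (real r)\<^sup>2)"] conjI exI[of _ 3] allI impI)
  show "0 < 1 / (18 * (real r)\<^sup>2)" using assms by simp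
  fix n :: nat assume n: "n \<ge> 3"
  define C where "C = 1 / (18 * (real r)\<^sup>2)"
  define q where "q = real n / ln n"
  define s where "s = (real r - 1) / r"
  \<comment> \<open>Here \<open>t\<close> is \<open>p * n\<close> rounded up. With
    \<open>N = r * n\<close> the window length \<open>(1 - p) * N / r\<close> becomes
    \<open>n - t\<close>, truncated to 0 if \<open>t\<close> exceeds \<open>n\<close>.\<close>
  define t where "t = nat \<lceil>2 * ln (real n)\<rceil>"
  define L where "L = n - t"
  define a where "a = real (min_edges n r)"
  have C: "C > 0" using assms by (simp add: C_def)
  have "exp 1 \<le> real n" using exp_le n by linarith
  then have ln1: "ln (real n) \<ge> 1" using n by (subst ln_ge_iff) auto
  have q: "1 \<le> q" "q \<le> n"
    using ln1 n ln_bound[of "real n"] by (auto simp: q_def field_simps)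
  have t: "2 * ln n \<le> real t" "real t \<le> 3 * ln n" using ln1 by (auto simp: t_def) linarith
  have "C * (real n / ln (real n)) powr ((real r - 1) / real r) * real r ^ n \<le> real (min_edges n r)"
  proof (rule ccontr)
    assume "\<not> ?thesis"
    then have a: "a \<le> C * q powr s * real r ^ n" by (simp add: a_def q_def s_def)
    obtain V :: "nat set" and E where VE: "hypergraph V E" "uniform n E" "\<not> colorable r V E"
      "card E = min_edges n r"
      using min_edges_attained[of r n] assms by auto
    have ge1: "1 \<le> a * (real (r * n) * (real L / real (r * n)) ^ n)
      + a ^ r * ((real (r * n - r * L) / real (r * n)) ^ (r - 1)
        * ((real (r * n) + r) / (r * real (r * n))) ^ (r * (n - 2)))"
      using not_colorable_imp_ge_1[OF VE(1-3), of "r * n" L] VE(4) assms n by (simp add: a_def)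
    \<comment> \<open>The 2 in \<open>t\<close> produces the square: one \<open>n\<close> cancels
      against \<open>N = r * n\<close>, the other absorbs \<open>q powr s\<close>.\<close>
    have "(real L / n) ^ n \<le> 1 / (real n)\<^sup>2"
    proof (cases "t < n")
      case True
      have "real L / n \<le> 1 - (2 * ln n) / n" using True t n by (simp add: L_def field_simps)
      then have "(real L / n) ^ n \<le> (1 - (2 * ln n) / n) ^ n" by (intro power_mono) auto
      also have "\<dots> \<le> exp (- (2 * ln n))"
        using True t n by (intro exp_ge_one_minus_x_over_n_power_n) auto
      also have "\<dots> = 1 / (real n)\<^sup>2"
        using n by (simp add: exp_minus exp_double inverse_eq_divide)
      finally show ?thesis .
    qed (use n in \<open>simp add: L_def zero_power\<close>)
    then have "real (r * n) * (real L / real (r * n)) ^ n \<le> real (r * n) * (1 / (real n)\<^sup>2 / real r ^ n)"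
      using n assms by (intro mult_left_mono) (simp_all add: power_divide power_mult_distrib field_simps)
    also have "\<dots> = real r / (n * real r ^ n)" using n by (simp add: power2_eq_square)
    finally have "a * (real (r * n) * (real L / real (r * n)) ^ n)
        \<le> (C * q powr s * real r ^ n) * (real r / (n * real r ^ n))"
      by (intro mult_mono a) (use C in \<open>auto simp: a_def\<close>)
    also have "\<dots> = C * r * (q powr s / n)" using assms by simp
    also have "\<dots> \<le> C * r * 1"
    proof (intro mult_left_mono)
      have "q powr s \<le> q powr 1" using q assms by (intro powr_mono) (auto simp: s_def field_simps)
      then show "q powr s / n \<le> 1" using q n by (simp add: field_simps)
    qed (use C in auto)
    also have "\<dots> \<le> 1 / 36" using assms by (simp add: C_def power2_eq_square field_simps)
    finally have T1: "a * (real (r * n) * (real L / real (r * n)) ^ n) \<le> 1 / 36" .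

    define y where "y = real r ^ (r * (n - 2))"
    have y: "y > 0" using assms by (simp add: y_def)
    \<comment> \<open>The exponent \<open>n - 2\<close> for interiors leaves \<open>r^2\<close> per
      edge uncancelled, hence the \<open>r^2\<close> in \<open>C\<close>.\<close>
    have ry: "(real r ^ n) ^ r = y * (real r ^ 2) ^ r"
    proof -
      have "n * r = r * (n - 2) + 2 * r" using n by (simp add: algebra_simps)
      then show ?thesis by (simp add: y_def flip: power_mult power_add)
    qed
    \<comment> \<open>The exponent \<open>s\<close> is chosen so that this power cancels the factor
      \<open>(3 / q) ^ (r - 1)\<close> from the joints.\<close>
    have "(q powr s) ^ r = q powr (real (r - 1))"
      using q assms by (simp add: powr_power s_def of_nat_diff)
    also have "\<dots> = q ^ (r - 1)" using q by (subst powr_realpow) auto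
    finally have qs: "(q powr s) ^ r = q ^ (r - 1)" .
    have "a ^ r \<le> (C * q powr s * real r ^ n) ^ r" by (intro power_mono a) (simp add: a_def)
    also have "\<dots> = C ^ r * q ^ (r - 1) * (y * (real r ^ 2) ^ r)"
      by (simp add: power_mult_distrib qs ry)
    finally have A: "a ^ r \<le> C ^ r * q ^ (r - 1) * (y * (real r ^ 2) ^ r)" .
    have "real (r * n - r * L) \<le> real (r * t)"
      unfolding of_nat_le_iff diff_mult_distrib2[symmetric] by (intro mult_left_mono) (auto simp: L_def)
    then have "real (r * n - r * L) / real (r * n) \<le> real (r * t) / real (r * n)"
      by (intro divide_right_mono) auto
    also have "\<dots> = real t / n" using assms by simp
    also have "\<dots> \<le> 3 / q" using t n by (simp add: q_def divide_right_mono)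
    finally have B: "(real (r * n - r * L) / real (r * n)) ^ (r - 1) \<le> (3 / q) ^ (r - 1)"
      by (intro power_mono) auto
    have "(real (r * n) + r) / (r * real (r * n)) = (1 + 1 / n) / r"
      using n assms by (simp add: field_simps)
    then have "((real (r * n) + r) / (r * real (r * n))) ^ (r * (n - 2)) = (1 + 1 / n) ^ (r * (n - 2)) / y"
      by (simp add: y_def power_divide)
    also have "(1 + 1 / real n) ^ (r * (n - 2)) \<le> (1 + 1 / real n) ^ (n * r)"
      by (intro power_increasing) (auto simp: algebra_simps)
    also have "\<dots> = ((1 + 1 / real n) ^ n) ^ r" by (simp add: power_mult)
    also have "\<dots> \<le> 3 ^ r"
    proof (intro power_mono)
      have "(1 + 1 / real n) ^ n \<le> exp 1" using n by (intro exp_ge_one_plus_x_over_n_power_n) auto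
      then show "(1 + 1 / real n) ^ n \<le> 3" using exp_le by linarith
    qed auto
    finally have D: "((real (r * n) + r) / (r * real (r * n))) ^ (r * (n - 2)) \<le> 3 ^ r / y"
      using y by (simp add: divide_right_mono)
    have "a ^ r * ((real (r * n - r * L) / real (r * n)) ^ (r - 1)
        * ((real (r * n) + r) / (r * real (r * n))) ^ (r * (n - 2)))
      \<le> (C ^ r * q ^ (r - 1) * (y * (real r ^ 2) ^ r)) * ((3 / q) ^ (r - 1) * (3 ^ r / y))"
      using C q y by (intro mult_mono A B D mult_nonneg_nonneg zero_le_power divide_nonneg_nonneg) auto
    also have "\<dots> = C ^ r * (real r ^ 2) ^ r * 3 ^ r * 3 ^ (r - 1)"
      using q y by (simp add: power_divide)
    also have "\<dots> \<le> C ^ r * (real r ^ 2) ^ r * 3 ^ r * 3 ^ r"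
      using C by (intro mult_left_mono power_increasing) auto
    also have "\<dots> = (C * real r ^ 2 * 3 * 3) ^ r" by (simp only: power_mult_distrib)
    also have "C * real r ^ 2 * 3 * 3 = 1 / 2" using assms by (simp add: C_def)
    also have "(1 / 2 :: real) ^ r \<le> (1 / 2) ^ 2" using assms by (intro power_decreasing) auto
    \<comment> \<open>The two terms are at most 1/36 and 1/4, so their sum is below 1.\<close>
    finally show False using ge1 T1 by (simp add: power2_eq_square)
  qed
  then show "1 / (18 * (real r)\<^sup>2) * (real n / ln (real n)) powr ((real r - 1) / real r) * real r ^ n
      \<le> real (min_edges n r)"
    by (simp only: C_def)
qed

end
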